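(* Let $\mathfrak{a}$ be an associative commutative unital algebra and let $\mathfrak{s}=\mathfrak{s}(0,\mathfrak{a})\cong\mathfrak{a}$ be the corresponding souped-up Lie algebra (with $\mathfrak{g}=0$). Let $I(\mathfrak{s})\subset F(\mathfrak{s})$ be the souped-up vertex algebra ideal formed with $N(s,t)\equiv 0$. Then the map taking $\mathfrak{s}$ to its image in $V(\mathfrak{s})=F(\mathfrak{s})/I(\mathfrak{s})$ is injective; equivalently, $I(\mathfrak{s})\cap\mathfrak{s}=\{0\}$.
   Context: Conventions. Vector spaces are over a fixed field of characteristic $0$ and are $\mathbf{Z}/2$-graded, with parity $p$; "commutative", "Lie algebra", etc. are meant in the super sense. For a vector space $\mathfrak{v}$ with a distinguished even nonzero vector $\mathbf{1}$, $F(\mathfrak{v})$ is the free nonassociative algebra on the vector space $\mathfrak{v}$ with bilinear products $x\circ_n y=x_ny$, $n\in\mathbf{Z}$ (no relations other than bilinearity; $p(x_ny)=p(x)+p(y)$); $\mathfrak{v}\subset F(\mathfrak{v})$. A monomial is an iterated product of elements of $\mathfrak{v}$. Ideals are closed under left and right multiplication by all elements for all $\circ_n$. Put $Dx=x_{-2}\mathbf{1}$. Vertex algebra ideal. Given $N(u,v)\ge 0$ on $\mathfrak{v}\times\mathfrak{v}$, $I(\mathfrak{v})$ is the ideal of $F(\mathfrak{v})$ generated, for $u,v\in\mathfrak{v}$ and (parity-homogeneous) $x,y,z\in F(\mathfrak{v})$, by - $\mathbf{1}_nx-\delta_{n,-1}x$; - $u_nv$ for all $n\ge N(u,v)$; -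 $D(x_ny)-(Dx)_ny-x_n(Dy)$; - $(Dx)_ny+n\,x_{n-1}y$ for all $n\in\mathbf{Z}$; - $x_ny+(-1)^{p(x)p(y)}\sum_{k\ge0}\frac{(-1)^{n+k}}{k!}D^k(y_{n+k}x)$; - $(x_my)_nz-\sum_{k\ge0}\binom{m}{k}(-1)^k\big(x_{m-k}(y_{n+k}z)-(-1)^{m+p(x)p(y)}y_{m+n-k}(x_kz)\big)$; where, unless indicated otherwise, each of $m,n$ ranges over $-1$ and all sufficiently large integers (threshold independent of $x,y,z$). The infinite sums are read modulo the ideal: for each $x,y$ one has $x_ny\in I(\mathfrak{v})$ for all large $n$, and terms lying in the ideal for this reason are dropped, so that each sum is finite. Souped-up Lie algebra $\mathfrak{s}=\mathfrak{s}(\mathfrak{g},\mathfrak{a})$: $\mathfrak{a}$ is an associative commutative unital algebra ($\mathbf{1}\ne0$), $\mathfrak{g}$ a Lie algebra which is a left $\mathfrak{a}$-module, $\mathfrak{a}$ is a $\mathfrak{g}$-module on which $\mathfrak{g}$ acts by derivations, written $[g,a]=-[a,g]$ (up to super signs), and $[g,ah]=[g,a]h+a[g,h]$. $\mathfrak{s}$ is the semidirect sum Lie algebra $\mathfrak{g}\oplus\mathfrak{a}$ ($\mathfrak{a}$ abelian) together with left multiplication by $\mathfrak{a}$; its distinguished vector is $\mathbf{1}\in\mathfrak{a}$. The souped-up vertex algebra ideal $I(\mathfrak{s})\subset F(\mathfrak{s})$ is generated by the generators above (for the unital vector space underlying $\mathfrak{s}$, with the function $N(s,t)$ on $\mathfrak{s}\times\mathfrak{s}$)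 and by $s_0t-[s,t]$, $a_{-1}s-as$, $(ab)_{-1}x-a_{-1}(b_{-1}x)$ for $a,b\in\mathfrak{a}$, $s,t\in\mathfrak{s}$, monomials $x\in F(\mathfrak{s})$. *)

theory Defs
  imports
    Complex_Main
    "HOL-Library.Poly_Mapping"
    "HOL-Library.Product_Plus"
    "HOL-Library.Z2"
    "HOL-Library.Numeral_Type"
begin

section \<open>Super vector spaces, algebras and Lie algebras\<close>

text \<open>Parities are elements of \<open>bit\<close>, the field with two elements.\<close>

definition psign :: "bit \<Rightarrow> 'k::field_char_0" where
  "psign e = (if e = 1 then -1 else 1)"

text \<open>\<open>gr i\<close> is the subspace of elements of parity \<open>i\<close>; the second assumption says that the
  space is the direct sum of \<open>gr 0\<close> and \<open>gr 1\<close>.\<close>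

locale super_space = vector_space scale
  for scale :: "'k::field_char_0 \<Rightarrow> 'v::ab_group_add \<Rightarrow> 'v" +
  fixes gr :: "bit \<Rightarrow> 'v set"
  assumes gr_subspace: "subspace (gr i)"
    and gr_direct: "\<exists>!y. y \<in> gr 0 \<and> x - y \<in> gr 1"

definition hcomp :: "(bit \<Rightarrow> 'v::ab_group_add set) \<Rightarrow> bit \<Rightarrow> 'v \<Rightarrow> 'v" where
  "hcomp gr i x = (THE y. y \<in> gr i \<and> x - y \<in> gr (i + 1))"

lemma (in super_space) hcomp_homogeneous:
  assumes "x \<in> gr i"
  shows "hcomp gr j x = (if j = i then x else 0)"
proof -
  have 0: "0 \<in> gr l" for l
    by (rule subspace_0[OF gr_subspace])
  have uniq: "y = z" if y: "y \<in> gr l" "x - y \<in> gr (l + 1)" and z: "z \<in> gr l" "x - z \<in> gr (l + 1)"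
    for y z l
  proof (cases "l = 0")
    case True
    then show ?thesis using y z gr_direct[of x] by auto
  next
    case False
    then have "l = 1" by simp
    then have "x - y \<in> gr 0 \<and> x - (x - y) \<in> gr 1" "x - z \<in> gr 0 \<and> x - (x - z) \<in> gr 1"
      using y z by auto
    then have "x - y = x - z" using gr_direct[of x] by blast
    then show ?thesis by simp
  qed
  have "(if j = i then x else 0) \<in> gr j \<and> x - (if j = i then x else 0) \<in> gr (j + 1)"
    using assms 0 by (cases i; cases j) auto
  then show ?thesis
    unfolding hcomp_def by (intro the_equality) (auto intro: uniq)
qed

definition bilinear_map ::
  "('k::field \<Rightarrow> 'u::ab_group_add \<Rightarrow> 'u) \<Rightarrow> ('k \<Rightarrow> 'v::ab_group_add \<Rightarrow> 'v) \<Rightarrow>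
   ('k \<Rightarrow> 'w::ab_group_add \<Rightarrow> 'w) \<Rightarrow> ('u \<Rightarrow> 'v \<Rightarrow> 'w) \<Rightarrow> bool" where
  "bilinear_map s1 s2 s3 f \<longleftrightarrow>
     (\<forall>y. Vector_Spaces.linear s1 s3 (\<lambda>x. f x y)) \<and> (\<forall>x. Vector_Spaces.linear s2 s3 (f x))"

definition even_map ::
  "(bit \<Rightarrow> 'u set) \<Rightarrow> (bit \<Rightarrow> 'v set) \<Rightarrow> (bit \<Rightarrow> 'w set) \<Rightarrow> ('u \<Rightarrow> 'v \<Rightarrow> 'w) \<Rightarrow> bool" where
  "even_map g1 g2 g3 f \<longleftrightarrow> (\<forall>i j. \<forall>x\<in>g1 i. \<forall>y\<in>g2 j. f x y \<in> g3 (i + j))"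

text \<open>Associativity, the unit and \<open>1 \<noteq> 0\<close> come from the class \<open>ring_1\<close>.\<close>

locale comm_superalgebra = super_space scale gr
  for scale :: "'k::field_char_0 \<Rightarrow> 'a::ring_1 \<Rightarrow> 'a" and gr +
  assumes mult_bilinear: "bilinear_map scale scale scale (*)"
    and mult_even: "even_map gr gr gr (*)"
    and one_even: "1 \<in> gr 0"
    and supercomm: "a \<in> gr i \<Longrightarrow> b \<in> gr j \<Longrightarrow> a * b = scale (psign (i * j)) (b * a)"

locale lie_superalgebra = super_space scale gr
  for scale :: "'k::field_char_0 \<Rightarrow> 'g::ab_group_add \<Rightarrow> 'g" and gr +
  fixes br :: "'g \<Rightarrow> 'g \<Rightarrow> 'g"
  assumes br_bilinear: "bilinear_map scale scale scale br"
    and br_even: "even_map gr gr gr br"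
    and br_skew: "x \<in> gr i \<Longrightarrow> y \<in> gr j \<Longrightarrow> br x y = - scale (psign (i * j)) (br y x)"
    and br_jacobi: "x \<in> gr i \<Longrightarrow> y \<in> gr j \<Longrightarrow> z \<in> gr l \<Longrightarrow>
      br x (br y z) = br (br x y) z + scale (psign (i * j)) (br y (br x z))"


section \<open>The free nonassociative algebra on a vector space\<close>

text \<open>
  \<open>('v, 'k) falg\<close> is the free nonassociative algebra on the underlying \<^emph>\<open>set\<close> of the vector
  space \<open>'v\<close>, with the products \<open>prd n\<close> for all integers \<open>n\<close>. The algebra \<open>F\<close> on the
  \<^emph>\<open>vector space\<close> \<open>'v\<close> is its quotient by the ideal \<open>lin_rel\<close>, which makes the inclusion of
  the generators linear. So the elements of \<open>F\<close> are the cosets \<open>cls x\<close>, and the operations of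
  \<open>F\<close> are those induced from representatives; see the lemmas at the end of this section.
\<close>

datatype 'v fmon = Leaf 'v | Node int "'v fmon" "'v fmon"

type_synonym ('v, 'k) falg = "'v fmon \<Rightarrow>\<^sub>0 'k"

definition mon :: "'v fmon \<Rightarrow> ('v, 'k::field_char_0) falg" where
  "mon t = Poly_Mapping.single t 1"

definition gen :: "'v \<Rightarrow> ('v, 'k::field_char_0) falg" where
  "gen u = mon (Leaf u)"

definition fscale :: "'k::field_char_0 \<Rightarrow> ('v, 'k) falg \<Rightarrow> ('v, 'k) falg" where
  "fscale c x = Poly_Mapping.map ((*) c) x"

definition prd :: "int \<Rightarrow> ('v, 'k::field_char_0) falg \<Rightarrow> ('v, 'k) falg \<Rightarrow> ('v, 'k) falg" where
  "prd n x y = (\<Sum>s\<in>Poly_Mapping.keys x. \<Sum>t\<in>Poly_Mapping.keys y.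
     Poly_Mapping.single (Node n s t) (Poly_Mapping.lookup x s * Poly_Mapping.lookup y t))"

inductive_set lin_rel :: "('k::field_char_0 \<Rightarrow> 'v::ab_group_add \<Rightarrow> 'v) \<Rightarrow> ('v, 'k) falg set"
  for scale where
  gen_add: "gen (u + v) - gen u - gen v \<in> lin_rel scale"
| gen_scale: "gen (scale c u) - fscale c (gen u) \<in> lin_rel scale"
| zero: "0 \<in> lin_rel scale"
| add: "x \<in> lin_rel scale \<Longrightarrow> y \<in> lin_rel scale \<Longrightarrow> x + y \<in> lin_rel scale"
| scale: "x \<in> lin_rel scale \<Longrightarrow> fscale c x \<in> lin_rel scale"
| prd_left: "x \<in> lin_rel scale \<Longrightarrow> prd n x y \<in> lin_rel scale"
| prd_right: "x \<in> lin_rel scale \<Longrightarrow> prd n y x \<in> lin_rel scale"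

definition cls ::
  "('k::field_char_0 \<Rightarrow> 'v::ab_group_add \<Rightarrow> 'v) \<Rightarrow> ('v, 'k) falg \<Rightarrow> ('v, 'k) falg set" where
  "cls scale x = {y. y - x \<in> lin_rel scale}"

definition F :: "('k::field_char_0 \<Rightarrow> 'v::ab_group_add \<Rightarrow> 'v) \<Rightarrow> ('v, 'k) falg set set" where
  "F scale = range (cls scale)"

inductive mon_parity :: "(bit \<Rightarrow> 'v set) \<Rightarrow> 'v fmon \<Rightarrow> bit \<Rightarrow> bool" for gr where
  "u \<in> gr i \<Longrightarrow> mon_parity gr (Leaf u) i"
| "mon_parity gr s i \<Longrightarrow> mon_parity gr t j \<Longrightarrow> mon_parity gr (Node n s t) (i + j)"

text \<open>Representatives of the elements of \<open>F\<close> of parity \<open>i\<close>: combinations of monomials in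
  homogeneous vectors whose parities add up to \<open>i\<close>.\<close>

definition hom :: "(bit \<Rightarrow> 'v set) \<Rightarrow> bit \<Rightarrow> ('v, 'k::field_char_0) falg set" where
  "hom gr i = {x. \<forall>t\<in>Poly_Mapping.keys x. mon_parity gr t i}"

definition is_ideal ::
  "('k::field_char_0 \<Rightarrow> 'v::ab_group_add \<Rightarrow> 'v) \<Rightarrow> ('v, 'k) falg set set \<Rightarrow> bool" where
  "is_ideal scale J \<longleftrightarrow>
     J \<subseteq> F scale \<and> cls scale 0 \<in> J \<and>
     (\<forall>x y. cls scale x \<in> J \<longrightarrow> cls scale y \<in> J \<longrightarrow> cls scale (x + y) \<in> J) \<and>
     (\<forall>c x. cls scale x \<in> J \<longrightarrow> cls scale (fscale c x) \<in> J) \<and>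
     (\<forall>n x y. cls scale x \<in> J \<longrightarrow> cls scale (prd n x y) \<in> J \<and> cls scale (prd n y x) \<in> J)"

text \<open>The projection from \<open>F\<close> to the quotient of \<open>F\<close> by an ideal \<open>J\<close>.\<close>

definition proj ::
  "('k::field_char_0 \<Rightarrow> 'v::ab_group_add \<Rightarrow> 'v) \<Rightarrow> ('v, 'k) falg set set \<Rightarrow>
   ('v, 'k) falg set \<Rightarrow> ('v, 'k) falg set set" where
  "proj scale J X = {Y \<in> F scale. \<exists>x\<in>X. \<exists>y\<in>Y. cls scale (y - x) \<in> J}"

lemma lookup_fscale: "Poly_Mapping.lookup (fscale c x) t = c * Poly_Mapping.lookup x t"
  by (auto simp: fscale_def map.rep_eq when_def)

lemma prd_sum_superset:
  assumes "finite S" "finite T" "Poly_Mapping.keys x \<subseteq> S" "Poly_Mapping.keys y \<subseteq> T"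
  shows "prd n x y = (\<Sum>s\<in>S. \<Sum>t\<in>T.
     Poly_Mapping.single (Node n s t) (Poly_Mapping.lookup x s * Poly_Mapping.lookup y t))"
proof -
  have "(\<Sum>s\<in>S. \<Sum>t\<in>T.
     Poly_Mapping.single (Node n s t) (Poly_Mapping.lookup x s * Poly_Mapping.lookup y t))
   = (\<Sum>s\<in>S. \<Sum>t\<in>Poly_Mapping.keys y.
     Poly_Mapping.single (Node n s t) (Poly_Mapping.lookup x s * Poly_Mapping.lookup y t))"
    using assms by (intro sum.cong refl sum.mono_neutral_right) (auto simp: in_keys_iff)
  also have "\<dots> = prd n x y"
    unfolding prd_def using assms
    by (intro sum.mono_neutral_right) (auto simp: in_keys_iff)
  finally show ?thesis by simp
qed

lemma prd_add_left: "prd n (x + x') y = prd n x y + prd n x' y"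
proof -
  let ?S = "Poly_Mapping.keys x \<union> Poly_Mapping.keys x'" and ?T = "Poly_Mapping.keys y"
  have "Poly_Mapping.keys (x + x') \<subseteq> ?S" by (rule Poly_Mapping.keys_add)
  then show ?thesis
    by (simp add: prd_sum_superset[of ?S ?T] lookup_add distrib_right single_add sum.distrib)
qed

lemma prd_add_right: "prd n x (y + y') = prd n x y + prd n x y'"
proof -
  let ?S = "Poly_Mapping.keys x" and ?T = "Poly_Mapping.keys y \<union> Poly_Mapping.keys y'"
  have "Poly_Mapping.keys (y + y') \<subseteq> ?T" by (rule Poly_Mapping.keys_add)
  then show ?thesis
    by (simp add: prd_sum_superset[of ?S ?T] lookup_add distrib_left single_add sum.distrib)
qed

lemma prd_diff_left: "prd n (x - x') y = prd n x y - prd n x' y"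
  using prd_add_left[of n "x - x'" x' y] by simp

lemma prd_diff_right: "prd n x (y - y') = prd n x y - prd n x y'"
  using prd_add_right[of n x "y - y'" y'] by simp

lemma lin_rel_uminus: "x \<in> lin_rel scale \<Longrightarrow> - x \<in> lin_rel scale"
  using lin_rel.scale[of x scale "-1"]
  by (metis lookup_fscale lookup_uminus mult_minus1 poly_mapping_eqI)

lemma cls_eq_iff: "cls scale x = cls scale y \<longleftrightarrow> x - y \<in> lin_rel scale"
proof
  assume "cls scale x = cls scale y"
  moreover have "x \<in> cls scale x" by (simp add: cls_def lin_rel.zero)
  ultimately show "x - y \<in> lin_rel scale" by (simp add: cls_def)
next
  assume a: "x - y \<in> lin_rel scale"
  have "z - x \<in> lin_rel scale \<longleftrightarrow> z - y \<in> lin_rel scale" for z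
    using lin_rel.add[OF _ a, of "z - x"] lin_rel.add[OF _ lin_rel_uminus[OF a], of "z - y"] by auto
  then show "cls scale x = cls scale y" by (simp add: cls_def)
qed

lemma cls_add_cong:
  assumes "cls scale x = cls scale x'" "cls scale y = cls scale y'"
  shows "cls scale (x + y) = cls scale (x' + y')"
  using lin_rel.add[OF assms[unfolded cls_eq_iff]] by (simp add: cls_eq_iff algebra_simps)

lemma cls_fscale_cong:
  assumes "cls scale x = cls scale x'"
  shows "cls scale (fscale c x) = cls scale (fscale c x')"
proof -
  have "fscale c (x - x') = fscale c x - fscale c x'"
    by (rule poly_mapping_eqI) (simp add: lookup_fscale lookup_minus right_diff_distrib)
  then show ?thesis
    using lin_rel.scale[OF assms[unfolded cls_eq_iff], of c] by (simp add: cls_eq_iff)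
qed

lemma cls_prd_cong:
  assumes "cls scale x = cls scale x'" "cls scale y = cls scale y'"
  shows "cls scale (prd n x y) = cls scale (prd n x' y')"
proof -
  have "prd n x y - prd n x' y' = prd n (x - x') y + prd n x' (y - y')"
    by (simp add: prd_diff_left prd_diff_right)
  then show ?thesis
    using assms lin_rel.add lin_rel.prd_left lin_rel.prd_right unfolding cls_eq_iff by metis
qed

lemma cls_gen_add: "cls scale (gen (u + v)) = cls scale (gen u + gen v)"
  using lin_rel.gen_add[of u v scale] by (simp add: cls_eq_iff algebra_simps)

lemma cls_gen_scale: "cls scale (gen (scale c u)) = cls scale (fscale c (gen u))"
  using lin_rel.gen_scale[of scale c u] by (simp add: cls_eq_iff)


section \<open>The generators of the vertex algebra ideal\<close>

definition idx :: "int \<Rightarrow> int set" where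
  "idx T = {n. n = -1 \<or> n \<ge> T}"

definition der :: "'v \<Rightarrow> ('v, 'k::field_char_0) falg \<Rightarrow> ('v, 'k) falg" where
  "der vac x = prd (-2) x (gen vac)"

text \<open>
  The generators depend on the ideal \<open>J\<close> modulo which the infinite sums are read: a sum is
  cut off at any \<open>K\<close> such that for all \<open>k \<ge> K\<close> the inner products occurring in the \<open>k\<close>-th
  term lie in \<open>J\<close>. The ideal generated by them is the least ideal \<open>J\<close> that contains the
  generators relative to \<open>J\<close>; as \<open>J\<close> is used only as an assumption of the form "lies in \<open>J\<close>",
  an intersection of such ideals is again one. The number \<open>T\<close> is the threshold beyond which indices are sufficiently large.
\<close>

definition va_gens ::
  "('k::field_char_0 \<Rightarrow> 'v::ab_group_add \<Rightarrow> 'v) \<Rightarrow> (bit \<Rightarrow> 'v set) \<Rightarrow> 'v \<Rightarrow>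
   ('v \<Rightarrow> 'v \<Rightarrow> nat) \<Rightarrow> int \<Rightarrow> ('v, 'k) falg set set \<Rightarrow> ('v, 'k) falg set set" where
  "va_gens scale gr vac N T J =
     {cls scale (prd n (gen vac) x - (if n = -1 then x else 0)) | n x. n \<in> idx T} \<union>
     {cls scale (prd n (gen u) (gen v)) | n u v. n \<ge> int (N u v)} \<union>
     {cls scale (der vac (prd n x y) - prd n (der vac x) y - prd n x (der vac y))
        | n x y. n \<in> idx T} \<union>
     {cls scale (prd n (der vac x) y + fscale (of_int n) (prd (n - 1) x y)) | n x y. True} \<union>
     {cls scale (prd n x y + fscale (psign (i * j))
        (\<Sum>k<K. fscale ((-1) powi (n + int k) / fact k) ((der vac ^^ k) (prd (n + int k) y x))))
        | n x y i j K. n \<in> idx T \<and> x \<in> hom gr i \<and> y \<in> hom gr j \<and>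
            (\<forall>k\<ge>K. cls scale (prd (n + int k) y x) \<in> J)} \<union>
     {cls scale (prd n (prd m x y) z -
        (\<Sum>k<K. fscale ((of_int m gchoose k) * (-1) ^ k)
           (prd (m - int k) x (prd (n + int k) y z) -
            fscale ((-1) powi m * psign (i * j)) (prd (m + n - int k) y (prd (int k) x z)))))
        | m n x y z i j l K. m \<in> idx T \<and> n \<in> idx T \<and>
            x \<in> hom gr i \<and> y \<in> hom gr j \<and> z \<in> hom gr l \<and>
            (\<forall>k\<ge>K. cls scale (prd (n + int k) y z) \<in> J \<and> cls scale (prd (int k) x z) \<in> J)}"


section \<open>Souped-up Lie algebras\<close>

text \<open>\<open>smul a h\<close> is the left action of \<open>a\<close> on \<open>h\<close>, and \<open>act g a\<close> is the bracket of \<open>g\<close>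
  with \<open>a\<close>.\<close>

locale souped_up_lie_algebra =
  A: comm_superalgebra scA grA + G: lie_superalgebra scG grG br
  for scA :: "'k::field_char_0 \<Rightarrow> 'a::ring_1 \<Rightarrow> 'a" and grA :: "bit \<Rightarrow> 'a set"
    and scG :: "'k \<Rightarrow> 'g::ab_group_add \<Rightarrow> 'g" and grG :: "bit \<Rightarrow> 'g set"
    and br :: "'g \<Rightarrow> 'g \<Rightarrow> 'g" +
  fixes smul :: "'a \<Rightarrow> 'g \<Rightarrow> 'g" and act :: "'g \<Rightarrow> 'a \<Rightarrow> 'a"
  assumes smul_bilinear: "bilinear_map scA scG scG smul"
    and smul_even: "even_map grA grG grG smul"
    and smul_one: "smul 1 h = h"
    and smul_assoc: "smul (a * b) h = smul a (smul b h)"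
    and act_bilinear: "bilinear_map scG scA scA act"
    and act_even: "even_map grG grA grA act"
    and act_br: "g \<in> grG i \<Longrightarrow> h \<in> grG j \<Longrightarrow>
      act (br g h) a = act g (act h a) - scA (psign (i * j)) (act h (act g a))"
    and act_mult: "g \<in> grG i \<Longrightarrow> a \<in> grA j \<Longrightarrow>
      act g (a * b) = act g a * b + scA (psign (i * j)) (a * act g b)"
    and br_smul: "g \<in> grG i \<Longrightarrow> a \<in> grA j \<Longrightarrow>
      br g (smul a h) = smul (act g a) h + scG (psign (i * j)) (smul a (br g h))"
begin

text \<open>The super space underlying the semidirect sum is \<open>'g \<times> 'a\<close>.\<close>

definition s_scale :: "'k \<Rightarrow> 'g \<times> 'a \<Rightarrow> 'g \<times> 'a" where
  "s_scale c s = (scG c (fst s), scA c (snd s))"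

definition s_gr :: "bit \<Rightarrow> ('g \<times> 'a) set" where
  "s_gr i = grG i \<times> grA i"

text \<open>The sum is the bilinear extension of the bracket of \<open>a\<close> with \<open>h\<close>, which for homogeneous
  \<open>a\<close>, \<open>h\<close> is minus the bracket of \<open>h\<close> with \<open>a\<close> up to the super sign.\<close>

definition s_br :: "'g \<times> 'a \<Rightarrow> 'g \<times> 'a \<Rightarrow> 'g \<times> 'a" where
  "s_br s t = (br (fst s) (fst t),
     act (fst s) (snd t) -
     (\<Sum>i\<in>{0, 1}. \<Sum>j\<in>{0, 1}.
        scA (psign (i * j)) (act (hcomp grG j (fst t)) (hcomp grA i (snd s)))))"

lemma s_br_homogeneous:
  assumes "a \<in> grA i" "h \<in> grG j"
  shows "s_br (0, a) (h, 0) = (0, - scA (psign (i * j)) (act h a))"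
proof -
  have 1: "module_hom scG scA (\<lambda>x. act x y)" "module_hom scA scA (act x)"
    "module_hom scG scG (\<lambda>x. br x z)" for x y z
    using act_bilinear G.br_bilinear by (auto simp: bilinear_map_def Vector_Spaces.linear_def)
  note z = 1[THEN module_hom.zero]
  show ?thesis
    using assms z by (cases i; cases j)
      (auto simp: s_br_def A.hcomp_homogeneous G.hcomp_homogeneous)
qed

definition s_mul :: "'a \<Rightarrow> 'g \<times> 'a \<Rightarrow> 'g \<times> 'a" where
  "s_mul a s = (smul a (fst s), a * snd s)"

definition s_vac :: "'g \<times> 'a" where
  "s_vac = (0, 1)"

definition souped_gens :: "('g \<times> 'a, 'k) falg set set" where
  "souped_gens =
     {cls s_scale (prd 0 (gen s) (gen t) - gen (s_br s t)) | s t. True} \<union>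
     {cls s_scale (prd (-1) (gen (0, a)) (gen s) - gen (s_mul a s)) | a s. True} \<union>
     {cls s_scale (prd (-1) (gen (0, a * b)) (mon x) -
        prd (-1) (gen (0, a)) (prd (-1) (gen (0, b)) (mon x))) | a b x. True}"

definition souped_ideal ::
  "('g \<times> 'a \<Rightarrow> 'g \<times> 'a \<Rightarrow> nat) \<Rightarrow> int \<Rightarrow> ('g \<times> 'a, 'k) falg set set" where
  "souped_ideal N T =
     \<Inter>{J. is_ideal s_scale J \<and> va_gens s_scale s_gr s_vac N T J \<subseteq> J \<and> souped_gens \<subseteq> J}"

text \<open>The inclusion of the vector space into \<open>F\<close>, and its composite with the projection to the
  quotient by the souped-up vertex algebra ideal.\<close>

definition s_in_F :: "'g \<times> 'a \<Rightarrow> ('g \<times> 'a, 'k) falg set" where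
  "s_in_F s = cls s_scale (gen s)"

definition s_to_V ::
  "('g \<times> 'a \<Rightarrow> 'g \<times> 'a \<Rightarrow> nat) \<Rightarrow> int \<Rightarrow> 'g \<times> 'a \<Rightarrow> ('g \<times> 'a, 'k) falg set set" where
  "s_to_V N T s = proj s_scale (souped_ideal N T) (s_in_F s)"

end

text \<open>Every algebra \<open>a\<close> forms a souped-up Lie algebra with the zero Lie algebra.\<close>

lemma souped_up_zero:
  fixes scA :: "'k::field_char_0 \<Rightarrow> 'a::ring_1 \<Rightarrow> 'a"
  assumes "comm_superalgebra scA grA"
  shows "souped_up_lie_algebra scA grA (\<lambda>_ _. 0 :: num1) (\<lambda>_. UNIV)
    (\<lambda>_ _. 0) (\<lambda>_ _. 0) (\<lambda>_ _. 0)"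
proof -
  have num1_zero: "x = y" for x y :: num1
    by (rule trans[OF num1_eq1 num1_eq1[symmetric]])
  interpret A: comm_superalgebra scA grA by fact
  interpret Z: vector_space "\<lambda>(_ :: 'k) (_ :: num1). 0 :: num1"
    by unfold_locales (rule num1_zero)+
  interpret Z: super_space "\<lambda>(_ :: 'k) (_ :: num1). 0 :: num1" "\<lambda>_. UNIV"
  proof unfold_locales
    show "\<exists>!y. y \<in> UNIV \<and> x - y \<in> UNIV" for x :: num1
      by (rule ex1I[of _ x]) (simp_all only: UNIV_I num1_zero[of _ x])
  qed (rule Z.subspace_UNIV)
  note lin = Vector_Spaces.linear_def module_hom_def module_hom_axioms_def
    A.module_axioms Z.module_axioms A.vector_space_axioms Z.vector_space_axioms
  have 0: "0 \<in> grA i" for i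
    by (rule A.subspace_0[OF A.gr_subspace])
  show ?thesis
    by unfold_locales
      (rule num1_zero | (simp only: bilinear_map_def even_map_def lin 0 UNIV_I
        A.scale_zero_right mult_zero_left mult_zero_right add_0_left diff_self; blast?))+
qed

end

theory Submission
  imports Defs
begin

text \<open>
  A commutative superalgebra \<open>A\<close> is a vertex algebra in the most degenerate way: let
  \<open>x\<^sub>-\<^sub>1y = xy\<close> and let all other products vanish. Its translation operator
  \<open>D x = x\<^sub>-\<^sub>2 1\<close> is zero, so that in every generator of the vertex algebra ideal only the
  products with index \<open>-1\<close> survive: skew symmetry becomes supercommutativity and the
  associativity formula becomes associativity.

  The linear map \<open>snd\<close> from the souped-up Lie algebra to \<open>A\<close> extends to a homomorphism from
  the free nonassociative algebra to \<open>A\<close> (\<open>eval\<close> below). Its kernel is an ideal that contains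
  all the generators relative to itself, as in \<open>va_gens_subset_eval_kernel\<close> and
  \<open>souped_gens_subset_eval_kernel\<close>, and hence contains the souped-up vertex algebra ideal. On
  the generating vectors the homomorphism is \<open>snd\<close>, which is injective if the Lie algebra is
  zero. Therefore no nonzero vector lies in the ideal.
\<close>

section \<open>Evaluation of the free algebra in a commutative superalgebra\<close>

context comm_superalgebra
begin

lemma scale_mult_scale: "scale c a * scale d b = scale (c * d) (a * b)"
proof -
  have "module_hom scale scale (\<lambda>x. x * y)" "module_hom scale scale ((*) x)" for x y
    using mult_bilinear by (auto simp: bilinear_map_def Vector_Spaces.linear_def)
  from this[THEN module_hom.scale] show ?thesis
    by simp
qed

fun eval_mon :: "('v \<Rightarrow> 'a) \<Rightarrow> 'v fmon \<Rightarrow> 'a" where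
  "eval_mon f (Leaf u) = f u"
| "eval_mon f (Node n s t) = (if n = -1 then eval_mon f s * eval_mon f t else 0)"

definition eval :: "('v \<Rightarrow> 'a) \<Rightarrow> ('v, 'k) falg \<Rightarrow> 'a" where
  "eval f x = (\<Sum>t\<in>Poly_Mapping.keys x. scale (Poly_Mapping.lookup x t) (eval_mon f t))"

lemma eval_superset:
  assumes "finite S" "Poly_Mapping.keys x \<subseteq> S"
  shows "eval f x = (\<Sum>t\<in>S. scale (Poly_Mapping.lookup x t) (eval_mon f t))"
  unfolding eval_def using assms
  by (intro sum.mono_neutral_left) (auto simp: in_keys_iff)

lemma eval_single: "eval f (Poly_Mapping.single t c) = scale c (eval_mon f t)"
  by (subst eval_superset[of "{t}"]) (auto simp: lookup_single)

lemma eval_mon_eq: "eval f (mon t) = eval_mon f t"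
  by (simp add: mon_def eval_single)

lemma eval_gen: "eval f (gen u) = f u"
  by (simp add: gen_def eval_mon_eq)

lemma eval_zero: "eval f 0 = 0"
  by (simp add: eval_def)

lemma eval_add: "eval f (x + y) = eval f x + eval f y"
proof -
  let ?S = "Poly_Mapping.keys x \<union> Poly_Mapping.keys y"
  have "Poly_Mapping.keys (x + y) \<subseteq> ?S" by (rule Poly_Mapping.keys_add)
  then show ?thesis
    by (simp add: eval_superset[of ?S] lookup_add scale_left_distrib sum.distrib)
qed

lemma eval_diff: "eval f (x - y) = eval f x - eval f y"
  using eval_add[of f "x - y" y] by simp

lemma eval_fscale: "eval f (fscale c x) = scale c (eval f x)"
proof -
  have "Poly_Mapping.keys (fscale c x) \<subseteq> Poly_Mapping.keys x"
    by (auto simp: in_keys_iff lookup_fscale)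
  then show ?thesis
    by (simp add: eval_superset[of "Poly_Mapping.keys x"] lookup_fscale scale_sum_right)
qed

lemma eval_sum: "eval f (sum g S) = (\<Sum>i\<in>S. eval f (g i))"
  by (induction S rule: infinite_finite_induct) (simp_all add: eval_zero eval_add)

lemma eval_prd: "eval f (prd n x y) = (if n = -1 then eval f x * eval f y else 0)"
proof -
  have "eval f (prd n x y) = (\<Sum>s\<in>Poly_Mapping.keys x. \<Sum>t\<in>Poly_Mapping.keys y.
      scale (Poly_Mapping.lookup x s * Poly_Mapping.lookup y t) (eval_mon f (Node n s t)))"
    by (simp add: prd_def eval_sum eval_single)
  also have "\<dots> = (if n = -1 then eval f x * eval f y else 0)"
    by (simp add: eval_def sum_product scale_mult_scale)
  finally show ?thesis .
qed

lemma eval_der: "eval f (der vac x) = 0"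
  by (simp add: der_def eval_prd)

lemma eval_der_power: "eval f ((der vac ^^ k) x) = (if k = 0 then eval f x else 0)"
  by (cases k) (simp_all add: eval_der)

lemma eval_mon_parity:
  assumes "mon_parity gr' t i" and even: "\<And>u j. u \<in> gr' j \<Longrightarrow> f u \<in> gr j"
  shows "eval_mon f t \<in> gr i"
  using assms(1)
proof induction
  case (2 s i t j n)
  then have "eval_mon f s * eval_mon f t \<in> gr (i + j)"
    using mult_even by (auto simp: even_map_def)
  then show ?case
    using subspace_0[OF gr_subspace] by simp
qed (simp add: even)

lemma eval_hom:
  assumes "x \<in> hom gr' i" and "\<And>u j. u \<in> gr' j \<Longrightarrow> f u \<in> gr j"
  shows "eval f x \<in> gr i"
  unfolding eval_def using assms
  by (intro subspace_sum[OF gr_subspace] subspace_scale[OF gr_subspace] eval_mon_parity)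
    (auto simp: hom_def)

end

section \<open>The kernel of evaluation contains the vertex algebra ideal\<close>

text \<open>
  A linear map \<open>f\<close> from a space with a distinguished vector to a commutative superalgebra,
  preserving parities and taking the distinguished vector to the unit. Linearity makes the
  evaluation descend from the free algebra on the underlying set to the free algebra on the vector
  space. Parities are needed for skew symmetry, and the distinguished vector for the unit axiom.
\<close>

locale even_unital_linear_map = comm_superalgebra scale gr
  for scale :: "'k::field_char_0 \<Rightarrow> 'a::ring_1 \<Rightarrow> 'a" and gr +
  fixes vscale :: "'k \<Rightarrow> 'v::ab_group_add \<Rightarrow> 'v" and vgr :: "bit \<Rightarrow> 'v set"
    and vac :: 'v and f :: "'v \<Rightarrow> 'a"
  assumes f_add: "f (u + v) = f u + f v"
    and f_scale: "f (vscale c u) = scale c (f u)"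
    and f_even: "u \<in> vgr i \<Longrightarrow> f u \<in> gr i"
    and f_vac: "f vac = 1"
begin

lemma eval_lin_rel: "x \<in> lin_rel vscale \<Longrightarrow> eval f x = 0"
  by (induction rule: lin_rel.induct)
    (simp_all add: eval_diff eval_gen f_add f_scale eval_fscale eval_zero eval_add eval_prd)

definition eval_kernel :: "('v, 'k) falg set set" where
  "eval_kernel = {cls vscale x | x. eval f x = 0}"

lemma cls_in_eval_kernel_iff: "cls vscale x \<in> eval_kernel \<longleftrightarrow> eval f x = 0"
proof
  assume "cls vscale x \<in> eval_kernel"
  then obtain y where "x - y \<in> lin_rel vscale" "eval f y = 0"
    by (auto simp: eval_kernel_def cls_eq_iff)
  then show "eval f x = 0"
    using eval_lin_rel[of "x - y"] by (simp add: eval_diff)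
qed (auto simp: eval_kernel_def)

lemma is_ideal_eval_kernel: "is_ideal vscale eval_kernel"
  unfolding is_ideal_def cls_in_eval_kernel_iff
  by (auto simp: eval_kernel_def F_def eval_zero eval_add eval_fscale eval_prd)

text \<open>
  Only \<open>n = -1\<close> and \<open>k = 0\<close> contribute, with coefficient \<open>-1\<close>. If the cut-off drops even this
  term, then the product of the values is zero anyway.
\<close>

lemma eval_skew_symmetry:
  assumes "x \<in> hom vgr i" "y \<in> hom vgr j"
    and cut: "\<And>k. k \<ge> K \<Longrightarrow> eval f (prd (n + int k) y x) = 0"
  shows "eval f (prd n x y + fscale (psign (i * j))
    (\<Sum>k<K. fscale ((-1) powi (n + int k) / fact k) ((der vac ^^ k) (prd (n + int k) y x)))) = 0"
proof -
  let ?p = "eval f y * eval f x"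
  have "(\<Sum>k<K. scale ((-1) powi (n + int k) / fact k)
      (eval f ((der vac ^^ k) (prd (n + int k) y x))))
    = (\<Sum>k<K. if k = 0 then (if n = -1 then - ?p else 0) else 0)"
    by (intro sum.cong refl) (auto simp: eval_der_power eval_prd)
  also have "\<dots> = (if n = -1 then - ?p else 0)"
    using cut[of 0] by (cases "K = 0") (auto simp: eval_prd split: if_splits)
  finally show ?thesis
    using supercomm[OF eval_hom[OF assms(1) f_even] eval_hom[OF assms(2) f_even]]
    by (simp add: eval_add eval_fscale eval_sum eval_prd)
qed

text \<open>
  The second summand contains \<open>x\<^sub>kz\<close> with \<open>k \<ge> 0\<close> and vanishes. The first one survives
  only for \<open>m - k = -1 = n + k\<close>; then \<open>m = k - 1\<close>, and the binomial coefficient is zero unless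
  \<open>k = 0\<close>. If the cut-off drops this term, then the product of the values of \<open>y\<close> and \<open>z\<close> is
  zero.
\<close>

lemma eval_associativity:
  assumes cut: "\<And>k. k \<ge> K \<Longrightarrow> eval f (prd (n + int k) y z) = 0"
  shows "eval f (prd n (prd m x y) z -
    (\<Sum>k<K. fscale ((of_int m gchoose k) * (-1) ^ k)
       (prd (m - int k) x (prd (n + int k) y z) -
        fscale e (prd (m + n - int k) y (prd (int k) x z))))) = 0"
proof -
  let ?p = "if m = -1 \<and> n = -1 then eval f x * (eval f y * eval f z) else 0"
  have summand: "scale ((of_int m gchoose k) * (-1) ^ k)
      (eval f (prd (m - int k) x (prd (n + int k) y z)) -
       scale e (eval f (prd (m + n - int k) y (prd (int k) x z))))
    = (if k = 0 then ?p else 0)" for k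
  proof (cases "k \<noteq> 0 \<and> m - int k = -1")
    case True
    then obtain l where "k = Suc l" "m = int l"
      by (cases k) auto
    then have "(of_int m gchoose k :: 'k) = 0"
      by (simp add: binomial_gbinomial[symmetric] del: of_nat_Suc)
    then show ?thesis using True by simp
  qed (auto simp: eval_prd)
  have "(\<Sum>k<K. if k = 0 then ?p else 0) = ?p"
    using cut[of 0] by (cases "K = 0") (auto simp: eval_prd)
  then show ?thesis
    by (simp add: eval_diff eval_fscale eval_sum summand) (simp add: eval_prd mult.assoc)
qed

lemma va_gens_subset_eval_kernel: "va_gens vscale vgr vac N T eval_kernel \<subseteq> eval_kernel"
proof
  have unit: "eval f (prd n (gen vac) x - (if n = -1 then x else 0)) = 0" for n x
    by (simp add: eval_diff eval_prd eval_gen eval_zero f_vac)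
  have locality: "eval f (prd n (gen u) (gen v)) = 0" if "n \<ge> int (N u v)" for n u v
    using that by (simp add: eval_prd)
  have derivation: "eval f (der vac (prd n x y) - prd n (der vac x) y - prd n x (der vac y)) = 0"
    for n x y
    by (simp add: eval_diff eval_prd eval_der)
  \<comment> \<open>The index \<open>n - 1\<close> is \<open>-1\<close> only if the coefficient \<open>n\<close> is zero.\<close>
  have translation: "eval f (prd n (der vac x) y + fscale (of_int n) (prd (n - 1) x y)) = 0"
    for n x y
    by (simp add: eval_add eval_fscale eval_prd eval_der)
  fix X assume "X \<in> va_gens vscale vgr vac N T eval_kernel"
  then show "X \<in> eval_kernel"
    unfolding va_gens_def
    by (elim UnE CollectE exE conjE; simp only: cls_in_eval_kernel_iff)
      (rule unit locality derivation translation eval_skew_symmetry eval_associativity;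
        (assumption | blast))+
qed

end

section \<open>Souped-up Lie algebras with zero Lie part\<close>

lemma snd_inj_if_trivial:
  assumes "(UNIV :: 'g set) = {0}" "snd s = snd t"
  shows "(s :: 'g::zero \<times> 'a) = t"
proof -
  have "x = 0" for x :: 'g
    using assms(1) by auto
  then have "fst s = fst t" by metis
  with assms(2) show ?thesis by (simp add: prod_eq_iff)
qed

context souped_up_lie_algebra
begin

sublocale even_unital_linear_map scA grA s_scale s_gr s_vac snd
  by unfold_locales (auto simp: s_scale_def s_gr_def s_vac_def)

lemma souped_gens_subset_eval_kernel:
  assumes "(UNIV :: 'g set) = {0}"
  shows "souped_gens \<subseteq> eval_kernel"
proof -
  have "module_hom scG scA (\<lambda>x. act x y)" for y
    using act_bilinear by (auto simp: bilinear_map_def Vector_Spaces.linear_def)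
  note act_zero = this[THEN module_hom.zero]
  have zero: "x = 0" for x :: 'g
    using assms by auto
  have act: "act x b = 0" for x b
    by (subst zero[of x]) (rule act_zero)
  then have "snd (s_br s t) = 0" for s t
    by (simp add: s_br_def)
  then show ?thesis
    unfolding souped_gens_def
    by (auto simp: cls_in_eval_kernel_iff A.eval_diff A.eval_prd A.eval_gen A.eval_mon_eq
        s_mul_def mult.assoc)
qed

lemma souped_ideal_subset_eval_kernel:
  assumes "(UNIV :: 'g set) = {0}"
  shows "souped_ideal N T \<subseteq> eval_kernel"
  unfolding souped_ideal_def
  using is_ideal_eval_kernel va_gens_subset_eval_kernel souped_gens_subset_eval_kernel[OF assms]
  by blast

lemma zero_in_souped_ideal: "cls s_scale 0 \<in> souped_ideal N T"
  by (auto simp: souped_ideal_def is_ideal_def)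

lemma inj_s_to_V:
  assumes "(UNIV :: 'g set) = {0}"
  shows "inj (s_to_V N T)"
proof (rule injI)
  fix s t assume eq: "s_to_V N T s = s_to_V N T t"
  have self: "gen s \<in> s_in_F s" for s
    by (simp add: s_in_F_def cls_def lin_rel.zero)
  have "s_in_F s \<in> s_to_V N T s"
    using self[of s] zero_in_souped_ideal
    by (auto simp: s_to_V_def proj_def F_def s_in_F_def intro!: bexI[of _ "gen s"])
  then obtain x y where x: "x \<in> s_in_F t" and y: "y \<in> s_in_F s"
    and "cls s_scale (y - x) \<in> souped_ideal N T"
    unfolding eq by (auto simp: s_to_V_def proj_def)
  then have "cls s_scale (y - x) \<in> eval_kernel"
    using souped_ideal_subset_eval_kernel[OF assms] by blast
  then have "A.eval snd y = A.eval snd x"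
    by (simp add: cls_in_eval_kernel_iff A.eval_diff)
  moreover have "A.eval snd z = snd r" if "z \<in> s_in_F r" for z r
    using that eval_lin_rel[of "z - gen r"]
    by (simp add: s_in_F_def cls_def A.eval_diff A.eval_gen)
  ultimately have "snd s = snd t"
    using x y by metis
  with assms show "s = t" by (rule snd_inj_if_trivial)
qed

lemma souped_ideal_Int_range:
  assumes "(UNIV :: 'g set) = {0}"
  shows "souped_ideal N T \<inter> range s_in_F = {cls s_scale 0}"
proof -
  have zero: "s_in_F 0 = cls s_scale 0"
    using lin_rel.gen_add[of 0 0 s_scale] lin_rel_uminus[of "- gen 0"]
    by (simp add: s_in_F_def cls_eq_iff)
  have "s = 0" if "s_in_F s \<in> souped_ideal N T" for s
  proof (rule snd_inj_if_trivial[OF assms])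
    have "cls s_scale (gen s) \<in> eval_kernel"
      using that souped_ideal_subset_eval_kernel[OF assms] by (auto simp: s_in_F_def)
    then show "snd s = snd 0"
      by (simp add: cls_in_eval_kernel_iff A.eval_gen)
  qed
  then show ?thesis
    using zero zero_in_souped_ideal[of N T] by blast
qed

end

theorem theorem4p4:
  fixes scA :: "'k::field_char_0 \<Rightarrow> 'a::ring_1 \<Rightarrow> 'a" and grA :: "bit \<Rightarrow> 'a set"
    and scG :: "'k \<Rightarrow> 'g::ab_group_add \<Rightarrow> 'g" and grG :: "bit \<Rightarrow> 'g set"
    and br :: "'g \<Rightarrow> 'g \<Rightarrow> 'g" and smul :: "'a \<Rightarrow> 'g \<Rightarrow> 'g" and act :: "'g \<Rightarrow> 'a \<Rightarrow> 'a"
    and T :: int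
  assumes "souped_up_lie_algebra scA grA scG grG br smul act"
    and "(UNIV :: 'g set) = {0}"
  shows "inj (souped_up_lie_algebra.s_to_V scA grA scG grG br smul act (\<lambda>s t. 0) T) \<and>
         souped_up_lie_algebra.souped_ideal scA grA scG grG br smul act (\<lambda>s t. 0) T
           \<inter> range (souped_up_lie_algebra.s_in_F scA scG)
         = {cls (souped_up_lie_algebra.s_scale scA scG) 0}"
proof -
  interpret souped_up_lie_algebra scA grA scG grG br smul act by fact
  show ?thesis
    using inj_s_to_V[OF assms(2)] souped_ideal_Int_range[OF assms(2)] by blast
qed

end
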